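(* (Identity Principle) Let $\Omega$ be a real-connected slice-domain in $\mathbb{H}$, and let $f,g$ be two slice regular functions on $\Omega$. If there exists $I\in\mathbb{S}$ such that $f$ and $g$ coincide on a subset of $\Omega_I$ having an accumulation point in $\Omega_I$, then $f=g$ on $\Omega$.
   Context: $\mathbb{H}$ is the skew field of quaternions, $\mathbb{S}=\{q\in\mathbb{H}:q^2=-1\}$, and for $I\in\mathbb{S}$, $\mathbb{C}_I=\{x+yI:x,y\in\mathbb{R}\}$ with the Euclidean topology. For $\Omega\subset\mathbb{H}$: $\Omega_I:=\Omega\cap\mathbb{C}_I$, $\Omega_{\mathbb{R}}:=\Omega\cap\mathbb{R}$. The slice-topology on $\mathbb{H}$ is the quotient topology induced by the natural map $\bigsqcup_{I\in\mathbb{S}}\mathbb{C}_I\to\mathbb{H}$; thus $\Omega$ is slice-open iff $\Omega_I$ is open in $\mathbb{C}_I$ for each $I\in\mathbb{S}$. A slice-domain in $\mathbb{H}$ is a set that is open and connected in the slice-topology. $\Omega$ is real-connected if $\Omega_{\mathbb{R}}$ is connected in $\mathbb{R}$ (the empty set counts as connected). A function from an open subset of $\mathbb{C}_I$ to $\mathbb{H}$ is (left) holomorphic if it has continuous partial derivatives and $\frac12(\frac{\partial}{\partial x}+I\frac{\partial}{\partial y})f(x+yI)=0$. A function $f:\Omega\to\mathbb{H}$ on a slice-open set is slice regular if $f|_{\Omega_I}$ is holomorphic for each $I\in\mathbb{S}$. *)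

theory Defs
  imports "HOL-Analysis.Analysis"
begin

section \<open>The skew field of quaternions\<close>

codatatype quaternion =
  Quaternion (QRe: real) (QI: real) (QJ: real) (QK: real)

lemma quaternion_eq_iff:
  "p = q \<longleftrightarrow> QRe p = QRe q \<and> QI p = QI q \<and> QJ p = QJ q \<and> QK p = QK q"
  by (auto intro: quaternion.expand)

instantiation quaternion :: ab_group_add
begin

primcorec zero_quaternion where
  "QRe 0 = 0"
| "QI 0 = 0"
| "QJ 0 = 0"
| "QK 0 = 0"

primcorec plus_quaternion where
  "QRe (p + q) = QRe p + QRe q"
| "QI (p + q) = QI p + QI q"
| "QJ (p + q) = QJ p + QJ q"
| "QK (p + q) = QK p + QK q"

primcorec uminus_quaternion where
  "QRe (- p) = - QRe p"
| "QI (- p) = - QI p"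
| "QJ (- p) = - QJ p"
| "QK (- p) = - QK p"

primcorec minus_quaternion where
  "QRe (p - q) = QRe p - QRe q"
| "QI (p - q) = QI p - QI q"
| "QJ (p - q) = QJ p - QJ q"
| "QK (p - q) = QK p - QK q"

instance
  by standard (simp_all add: quaternion_eq_iff)

end

instantiation quaternion :: ring_1
begin

primcorec one_quaternion where
  "QRe 1 = 1"
| "QI 1 = 0"
| "QJ 1 = 0"
| "QK 1 = 0"

primcorec times_quaternion where
  "QRe (p * q) = QRe p * QRe q - QI p * QI q - QJ p * QJ q - QK p * QK q"
| "QI (p * q) = QRe p * QI q + QI p * QRe q + QJ p * QK q - QK p * QJ q"
| "QJ (p * q) = QRe p * QJ q - QI p * QK q + QJ p * QRe q + QK p * QI q"
| "QK (p * q) = QRe p * QK q + QI p * QJ q - QJ p * QI q + QK p * QRe q"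

instance
  by standard (simp_all add: quaternion_eq_iff algebra_simps)

end

instantiation quaternion :: real_algebra_1
begin

primcorec scaleR_quaternion where
  "QRe (scaleR r q) = r * QRe q"
| "QI (scaleR r q) = r * QI q"
| "QJ (scaleR r q) = r * QJ q"
| "QK (scaleR r q) = r * QK q"

instance
  by standard (simp_all add: quaternion_eq_iff algebra_simps)

end

lemma sum4_squares_eq_0_iff:
  fixes a b c d :: real
  shows "a\<^sup>2 + b\<^sup>2 + c\<^sup>2 + d\<^sup>2 = 0 \<longleftrightarrow> a = 0 \<and> b = 0 \<and> c = 0 \<and> d = 0"
  by (simp add: add_nonneg_eq_0_iff)

instantiation quaternion :: real_inner
begin

definition inner_quaternion :: "quaternion \<Rightarrow> quaternion \<Rightarrow> real" where
  "inner_quaternion p q = QRe p * QRe q + QI p * QI q + QJ p * QJ q + QK p * QK q"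

definition norm_quaternion :: "quaternion \<Rightarrow> real" where
  "norm_quaternion q = sqrt ((QRe q)\<^sup>2 + (QI q)\<^sup>2 + (QJ q)\<^sup>2 + (QK q)\<^sup>2)"

definition sgn_quaternion :: "quaternion \<Rightarrow> quaternion" where
  "sgn_quaternion q = q /\<^sub>R norm q"

definition dist_quaternion :: "quaternion \<Rightarrow> quaternion \<Rightarrow> real" where
  "dist_quaternion p q = norm (p - q)"

definition [code del]:
  "(uniformity :: (quaternion \<times> quaternion) filter) =
     (INF e\<in>{0 <..}. principal {(p, q). dist p q < e})"

definition [code del]:
  "open (U :: quaternion set) \<longleftrightarrow> (\<forall>p\<in>U. eventually (\<lambda>(p', q). p' = p \<longrightarrow> q \<in> U) uniformity)"

instance
proof
  fix p q r :: quaternion and U :: "quaternion set" and a :: real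
  show "dist p q = norm (p - q)"
    by (rule dist_quaternion_def)
  show "sgn p = p /\<^sub>R norm p"
    by (rule sgn_quaternion_def)
  show "(uniformity :: (quaternion \<times> quaternion) filter) =
     (INF e\<in>{0 <..}. principal {(p, q). dist p q < e})"
    by (rule uniformity_quaternion_def)
  show "open U \<longleftrightarrow> (\<forall>p\<in>U. eventually (\<lambda>(p', q). p' = p \<longrightarrow> q \<in> U) uniformity)"
    by (rule open_quaternion_def)
  show "inner p q = inner q p"
    by (simp add: inner_quaternion_def mult.commute)
  show "inner (p + q) r = inner p r + inner q r"
    by (simp add: inner_quaternion_def algebra_simps)
  show "inner (a *\<^sub>R p) q = a * inner p q"
    by (simp add: inner_quaternion_def algebra_simps)
  show "0 \<le> inner p p"
    by (simp add: inner_quaternion_def)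
  show "inner p p = 0 \<longleftrightarrow> p = 0"
    using sum4_squares_eq_0_iff[of "QRe p" "QI p" "QJ p" "QK p"]
    by (simp add: inner_quaternion_def quaternion_eq_iff power2_eq_square)
  show "norm p = sqrt (inner p p)"
    by (simp add: norm_quaternion_def inner_quaternion_def power2_eq_square)
qed

end

instantiation quaternion :: real_normed_div_algebra
begin

primcorec inverse_quaternion where
  "QRe (inverse q) = QRe q / ((QRe q)\<^sup>2 + (QI q)\<^sup>2 + (QJ q)\<^sup>2 + (QK q)\<^sup>2)"
| "QI (inverse q) = - QI q / ((QRe q)\<^sup>2 + (QI q)\<^sup>2 + (QJ q)\<^sup>2 + (QK q)\<^sup>2)"
| "QJ (inverse q) = - QJ q / ((QRe q)\<^sup>2 + (QI q)\<^sup>2 + (QJ q)\<^sup>2 + (QK q)\<^sup>2)"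
| "QK (inverse q) = - QK q / ((QRe q)\<^sup>2 + (QI q)\<^sup>2 + (QJ q)\<^sup>2 + (QK q)\<^sup>2)"

definition divide_quaternion :: "quaternion \<Rightarrow> quaternion \<Rightarrow> quaternion" where
  "divide_quaternion p q = p * inverse q"

instance
proof
  fix p q :: quaternion
  show "inverse p * p = 1" "p * inverse p = 1" if "p \<noteq> 0"
  proof -
    define n where "n = (QRe p)\<^sup>2 + (QI p)\<^sup>2 + (QJ p)\<^sup>2 + (QK p)\<^sup>2"
    have "n \<noteq> 0"
      using that sum4_squares_eq_0_iff[of "QRe p" "QI p" "QJ p" "QK p"]
      by (simp add: n_def quaternion_eq_iff)
    moreover have "QRe p * QRe p + QI p * QI p + QJ p * QJ p + QK p * QK p = n"
      by (simp add: n_def power2_eq_square)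
    ultimately show "inverse p * p = 1" "p * inverse p = 1"
      by (simp_all add: quaternion_eq_iff n_def[symmetric] mult.commute
          add_divide_distrib[symmetric] diff_divide_distrib[symmetric])
  qed
  show "p div q = p * inverse q"
    by (rule divide_quaternion_def)
  show "inverse (0 :: quaternion) = 0"
    by (simp add: quaternion_eq_iff)
  show "norm (p * q) = norm p * norm q"
    unfolding norm_quaternion_def real_sqrt_mult[symmetric] real_sqrt_eq_iff times_quaternion.sel
    by (simp add: power2_eq_square algebra_simps)
qed

end

instantiation quaternion :: euclidean_space
begin

definition Basis_quaternion :: "quaternion set" where
  "Basis_quaternion =
     {Quaternion 1 0 0 0, Quaternion 0 1 0 0, Quaternion 0 0 1 0, Quaternion 0 0 0 1}"

instance
proof
  show "(Basis :: quaternion set) \<noteq> {}" "finite (Basis :: quaternion set)"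
    by (simp_all add: Basis_quaternion_def)
  show "inner p q = (if p = q then 1 else 0)" if "p \<in> Basis" "q \<in> Basis" for p q :: quaternion
    using that unfolding Basis_quaternion_def by (elim insertE emptyE) (simp_all add: inner_quaternion_def)
  show "(\<forall>u\<in>Basis. inner p u = 0) \<longleftrightarrow> p = 0" for p :: quaternion
    by (simp add: Basis_quaternion_def inner_quaternion_def) (simp add: quaternion_eq_iff)
qed

end

lemma QRe_of_real [simp]: "QRe (of_real r) = r"
  and QI_of_real [simp]: "QI (of_real r) = 0"
  and QJ_of_real [simp]: "QJ (of_real r) = 0"
  and QK_of_real [simp]: "QK (of_real r) = 0"
  by (simp_all add: of_real_def)


section \<open>Slices and the slice-topology\<close>

definition imag_units :: "quaternion set" where
  "imag_units = {q. q\<^sup>2 = -1}"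

definition slice_point :: "quaternion \<Rightarrow> real \<Rightarrow> real \<Rightarrow> quaternion" where
  "slice_point I x y = of_real x + of_real y * I"

definition slice_plane :: "quaternion \<Rightarrow> quaternion set" where
  "slice_plane I = {slice_point I x y |x y. True}"

definition slice_sum :: "(quaternion \<times> quaternion) topology" where
  "slice_sum = sum_topology (\<lambda>I. top_of_set (slice_plane I)) imag_units"

text \<open>
  The natural map from the disjoint union of the planes to the quaternions is
  \<^const>\<open>snd\<close>; the slice-topology is the finest topology making it continuous.
\<close>

definition slice_topology :: "quaternion topology" where
  "slice_topology = topology (\<lambda>U. openin slice_sum {p \<in> topspace slice_sum. snd p \<in> U})"

lemma openin_slice_topology:
  "openin slice_topology U \<longleftrightarrow> openin slice_sum {p \<in> topspace slice_sum. snd p \<in> U}"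
proof -
  have "istopology (\<lambda>U. openin slice_sum {p \<in> topspace slice_sum. snd p \<in> U})"
    unfolding istopology_def
  proof (intro conjI allI impI)
    fix S T
    assume "openin slice_sum {p \<in> topspace slice_sum. snd p \<in> S}"
      and "openin slice_sum {p \<in> topspace slice_sum. snd p \<in> T}"
    then have "openin slice_sum ({p \<in> topspace slice_sum. snd p \<in> S} \<inter>
        {p \<in> topspace slice_sum. snd p \<in> T})"
      by (rule openin_Int)
    moreover have "{p \<in> topspace slice_sum. snd p \<in> S} \<inter> {p \<in> topspace slice_sum. snd p \<in> T}
        = {p \<in> topspace slice_sum. snd p \<in> S \<inter> T}"
      by blast
    ultimately show "openin slice_sum {p \<in> topspace slice_sum. snd p \<in> S \<inter> T}"
      by simp
  next
    fix \<K>
    assume "\<forall>K\<in>\<K>. openin slice_sum {p \<in> topspace slice_sum. snd p \<in> K}"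
    then have "openin slice_sum (\<Union>K\<in>\<K>. {p \<in> topspace slice_sum. snd p \<in> K})"
      by (intro openin_Union) blast
    moreover have "(\<Union>K\<in>\<K>. {p \<in> topspace slice_sum. snd p \<in> K})
        = {p \<in> topspace slice_sum. snd p \<in> \<Union>\<K>}"
      by blast
    ultimately show "openin slice_sum {p \<in> topspace slice_sum. snd p \<in> \<Union>\<K>}"
      by simp
  qed
  then show ?thesis
    by (simp add: slice_topology_def)
qed

lemma openin_slice_topology_iff:
  "openin slice_topology U \<longleftrightarrow>
     (\<forall>I\<in>imag_units. openin (top_of_set (slice_plane I)) (U \<inter> slice_plane I))"
proof -
  have "{x. (I, x) \<in> {p \<in> topspace slice_sum. snd p \<in> U}} = U \<inter> slice_plane I"
    if "I \<in> imag_units" for I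
    using that by (auto simp: slice_sum_def)
  then show ?thesis
    unfolding openin_slice_topology slice_sum_def openin_sum_topology by auto
qed

lemma topspace_slice_topology [simp]: "topspace slice_topology = UNIV"
proof -
  have "openin slice_topology UNIV"
    by (simp add: openin_slice_topology)
  then show ?thesis
    using openin_subset by blast
qed

lemma ex_slice_plane: "\<exists>I\<in>imag_units. q \<in> slice_plane I"
proof (cases "QI q = 0 \<and> QJ q = 0 \<and> QK q = 0")
  case True
  have "Quaternion 0 1 0 0 \<in> imag_units"
    by (simp add: imag_units_def power2_eq_square quaternion_eq_iff)
  moreover have "q = slice_point (Quaternion 0 1 0 0) (QRe q) 0"
    using True by (simp add: slice_point_def quaternion_eq_iff)
  ultimately show ?thesis
    unfolding slice_plane_def by blast
next
  case False
  define n where "n = sqrt ((QI q)\<^sup>2 + (QJ q)\<^sup>2 + (QK q)\<^sup>2)"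
  define J where "J = Quaternion 0 (QI q / n) (QJ q / n) (QK q / n)"
  have n2: "n\<^sup>2 = (QI q)\<^sup>2 + (QJ q)\<^sup>2 + (QK q)\<^sup>2"
    by (simp add: n_def)
  moreover have "(QI q)\<^sup>2 + (QJ q)\<^sup>2 + (QK q)\<^sup>2 \<noteq> 0"
    using False sum4_squares_eq_0_iff[of 0 "QI q" "QJ q" "QK q"] by auto
  ultimately have n: "n \<noteq> 0"
    by auto
  have "- (QI q / n * (QI q / n)) - QJ q / n * (QJ q / n) - QK q / n * (QK q / n)
      = - (((QI q)\<^sup>2 + (QJ q)\<^sup>2 + (QK q)\<^sup>2) / n\<^sup>2)"
    by (simp add: power2_eq_square add_divide_distrib)
  also have "\<dots> = -1"
    unfolding n2[symmetric] using n by simp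
  finally have "J \<in> imag_units"
    by (simp add: imag_units_def power2_eq_square quaternion_eq_iff J_def)
  moreover have "q = slice_point J (QRe q) n"
    using n by (simp add: slice_point_def quaternion_eq_iff J_def)
  ultimately show ?thesis
    unfolding slice_plane_def by blast
qed

lemma quotient_map_slice_topology: "quotient_map slice_sum slice_topology snd"
proof -
  have "\<exists>p \<in> topspace slice_sum. snd p = q" for q
    using ex_slice_plane[of q] by (force simp: slice_sum_def)
  then have "snd ` topspace slice_sum = UNIV"
    by (metis UNIV_eq_I imageI)
  then show ?thesis
    by (simp add: quotient_map_def openin_slice_topology)
qed

definition slice_domain :: "quaternion set \<Rightarrow> bool" where
  "slice_domain \<Omega> \<longleftrightarrow> openin slice_topology \<Omega> \<and> connectedin slice_topology \<Omega>"

definition real_connected :: "quaternion set \<Rightarrow> bool" where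
  "real_connected \<Omega> \<longleftrightarrow> connected (\<Omega> \<inter> \<real>)"


section \<open>Slice regular functions\<close>

text \<open>
  The witnesses \<open>fx\<close> and \<open>fy\<close> are the partial derivatives of \<open>f\<close> in the coordinates
  \<open>x + yI\<close>. As \<open>U\<close> is open in the plane, they are determined on \<open>U\<close> by the values of
  \<open>f\<close> on \<open>U\<close>.
\<close>

definition slice_holomorphic_on :: "quaternion \<Rightarrow> quaternion set \<Rightarrow> (quaternion \<Rightarrow> quaternion) \<Rightarrow> bool"
  where
  "slice_holomorphic_on I U f \<longleftrightarrow>
     openin (top_of_set (slice_plane I)) U \<and>
     (\<exists>fx fy. continuous_on U fx \<and> continuous_on U fy \<and>
       (\<forall>x y. slice_point I x y \<in> U \<longrightarrow>
         ((\<lambda>t. f (slice_point I t y)) has_vector_derivative fx (slice_point I x y)) (at x) \<and>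
         ((\<lambda>t. f (slice_point I x t)) has_vector_derivative fy (slice_point I x y)) (at y) \<and>
         (1/2) *\<^sub>R (fx (slice_point I x y) + I * fy (slice_point I x y)) = 0))"

definition slice_regular_on :: "quaternion set \<Rightarrow> (quaternion \<Rightarrow> quaternion) \<Rightarrow> bool" where
  "slice_regular_on \<Omega> f \<longleftrightarrow>
     openin slice_topology \<Omega> \<and> (\<forall>I\<in>imag_units. slice_holomorphic_on I (\<Omega> \<inter> slice_plane I) f)"

end

theory Submission
  imports Defs "HOL-Complex_Analysis.Complex_Analysis"
begin

text \<open>
  Let \<open>h = f - g\<close>. For every quaternion \<open>v\<close> the map \<open>q \<mapsto> \<langle>q, v\<rangle> - \<i> \<langle>I q, v\<rangle>\<close> carries left
  multiplication by \<open>I\<close> to multiplication by \<open>\<i>\<close>, so it turns the restriction of \<open>h\<close> to a slice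
  into an ordinary holomorphic function; hence, if zeros of \<open>h\<close> in a slice accumulate at a point of
  \<open>\<Omega>\<close>, then \<open>h\<close> vanishes near that point in the slice. At a real point \<open>h\<close> then vanishes on a real
  interval, which lies in all slices, so the zeros accumulate there in every slice. Therefore the
  set of accumulation points of zeros within slices is open and closed in \<open>\<Omega>\<close> for the
  slice-topology, and it is all of \<open>\<Omega>\<close> by connectedness.
\<close>

section \<open>Complex holomorphy from the Cauchy-Riemann equation\<close>

text \<open>The partial derivative in \<open>x\<close> together with a continuous one in
  \<open>y\<close> gives a total real derivative. The Cauchy-Riemann equation makes this real linear
  map multiplication by \<open>Fx z\<close>.\<close>

lemma holomorphic_on_if_continuous_partials:
  fixes F Fx Fy :: "complex \<Rightarrow> complex"
  assumes "open V" "continuous_on V Fy"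
    and Fx: "\<And>z. z \<in> V \<Longrightarrow> ((\<lambda>t. F (Complex t (Im z))) has_vector_derivative Fx z) (at (Re z))"
    and Fy: "\<And>z. z \<in> V \<Longrightarrow> ((\<lambda>t. F (Complex (Re z) t)) has_vector_derivative Fy z) (at (Im z))"
    and CR: "\<And>z. z \<in> V \<Longrightarrow> Fy z = \<i> * Fx z"
  shows "F holomorphic_on V"
proof -
  have "F field_differentiable (at w)" if w: "w \<in> V" for w
  proof -
    define P :: "(real \<times> real) set" where "P = (\<lambda>(x, y). Complex x y) -` V"
    have contC: "continuous_on UNIV (\<lambda>(x, y). Complex x y)"
      by (auto simp: case_prod_unfold Complex_eq intro!: continuous_intros)
    have "open P"
      unfolding P_def using continuous_on_open_vimage[OF open_UNIV, of "\<lambda>(x, y). Complex x y"]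
        contC \<open>open V\<close> by simp
    moreover have "(Re w, Im w) \<in> P"
      using w by (simp add: P_def)
    ultimately obtain A B where "open A" "open B" "(Re w, Im w) \<in> A \<times> B" "A \<times> B \<subseteq> P"
      by (rule open_prod_elim)
    then have AB: "open A" "open B" "Re w \<in> A" "Im w \<in> B" "A \<times> B \<subseteq> P"
      by simp_all
    \<comment> \<open>The rule for partial derivatives integrates along the second variable, so the
      second factor is shrunk to a convex set.\<close>
    then obtain e where e: "e > 0" "ball (Im w) e \<subseteq> B"
      by (meson openE)
    define Y where "Y = ball (Im w) e"
    have AY: "Complex x y \<in> V" if "x \<in> A" "y \<in> Y" for x y
    proof -
      have "(x, y) \<in> P"
        using that AB e unfolding Y_def by blast
      then show ?thesis
        by (simp add: P_def)
    qed
    have Y: "open Y" "convex Y" "Im w \<in> Y"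
      using e by (auto simp: Y_def)
    have "((\<lambda>(x, y). F (Complex x y)) has_derivative
        (\<lambda>(tx, ty). tx *\<^sub>R Fx w + blinfun_scaleR_left (Fy (Complex (Re w) (Im w))) ty))
        (at (Re w, Im w) within A \<times> Y)"
    \<comment> \<open>The derivative in \<open>y\<close> must vary continuously as a bounded linear
      map, so it is written as scaling of the vector \<open>Fy\<close>.\<close>
    proof (rule has_derivative_partialsI[where fy = "\<lambda>x y. blinfun_scaleR_left (Fy (Complex x y))"])
      show "((\<lambda>x. F (Complex x (Im w))) has_derivative (\<lambda>tx. tx *\<^sub>R Fx w)) (at (Re w) within A)"
        using Fx[OF w] by (simp add: has_vector_derivative_def has_derivative_at_withinI)
      show "((\<lambda>y. F (Complex x y)) has_derivative
          blinfun_apply (blinfun_scaleR_left (Fy (Complex x y)))) (at y within Y)"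
        if "x \<in> A" "y \<in> Y" for x y
        using Fy[OF AY[OF that]] by (simp add: has_vector_derivative_def has_derivative_at_withinI)
      have "continuous_on (A \<times> Y) (\<lambda>(x, y). Fy (Complex x y))"
        unfolding case_prod_unfold
        by (rule continuous_on_compose2[OF \<open>continuous_on V Fy\<close>])
          (use AY in \<open>auto simp: Complex_eq intro!: continuous_intros\<close>)
      then have "continuous_on (A \<times> Y) (\<lambda>z. blinfun_scaleR_left (Fy (Complex (fst z) (snd z))))"
        by (auto simp: case_prod_unfold intro!: bounded_linear.continuous_on[OF bounded_linear_blinfun_scaleR_left])
      then show "continuous (at (Re w, Im w) within A \<times> Y)
          (\<lambda>(x, y). blinfun_scaleR_left (Fy (Complex x y)))"
        using AB Y by (simp add: continuous_on_eq_continuous_within case_prod_unfold)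
    qed (use Y in auto)
    then have "((\<lambda>(x, y). F (Complex x y)) has_derivative (\<lambda>(tx, ty). tx *\<^sub>R Fx w + ty *\<^sub>R Fy w))
        (at (Re w, Im w))"
      using AB Y by (simp add: at_within_open[OF _ open_Times])
    then have "((\<lambda>z. (\<lambda>(x, y). F (Complex x y)) (Re z, Im z)) has_derivative
        (\<lambda>t. (\<lambda>(tx, ty). tx *\<^sub>R Fx w + ty *\<^sub>R Fy w) (Re t, Im t))) (at w)"
      by (rule has_derivative_compose[rotated]) (auto intro!: derivative_eq_intros)
    \<comment> \<open>Substituting \<open>Fy w = \<i> * Fx w\<close> collects the coefficients into
      \<open>Re t + \<i> * Im t = t\<close>.\<close>
    moreover have "Re t *\<^sub>R Fx w + Im t *\<^sub>R Fy w = Fx w * t" for t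
      using CR[OF w] by (simp add: complex_eq_iff algebra_simps)
    ultimately have "(F has_field_derivative Fx w) (at w)"
      by (simp add: has_field_derivative_def)
    then show ?thesis
      unfolding field_differentiable_def by blast
  qed
  then show ?thesis
    by (simp add: holomorphic_on_def field_differentiable_at_within)
qed


section \<open>Slices\<close>

text \<open>Coordinates that send \<i> to \<open>I\<close>. For an imaginary unit they are
  isometric, so discs and limit points move between the complex plane and the slice with the same
  radii.\<close>

definition slice_embed :: "quaternion \<Rightarrow> complex \<Rightarrow> quaternion" where
  "slice_embed I z = slice_point I (Re z) (Im z)"

lemma slice_plane_eq_range: "slice_plane I = range (slice_embed I)"
proof -
  have "slice_point I x y = slice_embed I (Complex x y)" for x y
    by (simp add: slice_embed_def)
  then show ?thesis
    by (auto simp: slice_plane_def) (auto simp: slice_embed_def)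
qed

text \<open>The imaginary part of \<open>I\<^sup>2\<close> is twice the real part of
  \<open>I\<close> times its imaginary part. A nonzero real part would therefore kill the imaginary
  part and leave a real number with square -1.\<close>

lemma imag_units_iff:
  "I \<in> imag_units \<longleftrightarrow> QRe I = 0 \<and> (QI I)\<^sup>2 + (QJ I)\<^sup>2 + (QK I)\<^sup>2 = 1"
proof
  assume "I \<in> imag_units"
  then have eq: "(QRe I)\<^sup>2 - (QI I)\<^sup>2 - (QJ I)\<^sup>2 - (QK I)\<^sup>2 = -1"
    and im: "QRe I = 0 \<or> (QI I = 0 \<and> QJ I = 0 \<and> QK I = 0)"
    by (auto simp: imag_units_def power2_eq_square quaternion_eq_iff)
  have "QRe I = 0"
  proof (rule ccontr)
    assume "QRe I \<noteq> 0"
    with im eq have "(QRe I)\<^sup>2 = -1"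
      by simp
    then show False
      using zero_le_power2[of "QRe I"] by linarith
  qed
  with eq show "QRe I = 0 \<and> (QI I)\<^sup>2 + (QJ I)\<^sup>2 + (QK I)\<^sup>2 = 1"
    by simp
qed (auto simp: imag_units_def power2_eq_square quaternion_eq_iff)

text \<open>By \<open>imag_units_iff\<close>, 1 and \<open>I\<close> are orthonormal.\<close>

lemma norm_slice_embed:
  assumes "I \<in> imag_units"
  shows "norm (slice_embed I z) = cmod z"
proof -
  have "(Im z * QI I)\<^sup>2 + (Im z * QJ I)\<^sup>2 + (Im z * QK I)\<^sup>2
      = (Im z)\<^sup>2 * ((QI I)\<^sup>2 + (QJ I)\<^sup>2 + (QK I)\<^sup>2)"
    by (simp add: power_mult_distrib algebra_simps)
  with assms show ?thesis
    by (simp add: imag_units_iff norm_quaternion_def slice_embed_def slice_point_def cmod_def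
        add.assoc)
qed

lemma slice_embed_diff: "slice_embed I z - slice_embed I w = slice_embed I (z - w)"
  by (simp add: slice_embed_def slice_point_def algebra_simps)

lemma dist_slice_embed:
  "I \<in> imag_units \<Longrightarrow> dist (slice_embed I z) (slice_embed I w) = dist z w"
  by (simp add: dist_norm slice_embed_diff norm_slice_embed)

lemma continuous_on_slice_embed: "continuous_on S (slice_embed I)"
  unfolding slice_embed_def slice_point_def by (intro continuous_intros)

lemma open_vimage_slice_embed:
  assumes "openin (top_of_set (slice_plane I)) U"
  shows "open (slice_embed I -` U)"
  using continuous_openin_preimage[OF continuous_on_slice_embed[of UNIV I] _ assms]
  by (auto simp: slice_plane_eq_range)

lemma of_real_in_slice_plane [simp]: "of_real r \<in> slice_plane I"
proof -
  have "of_real r = slice_point I r 0"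
    by (simp add: slice_point_def)
  then show ?thesis
    unfolding slice_plane_def by blast
qed

text \<open>At a common nonreal point the coefficient of \<open>J\<close> is nonzero, so one can
  solve for \<open>J\<close> as a real combination of 1 and \<open>I\<close>. Applied in both
  directions, this shows that two planes with a common nonreal point are equal.\<close>

lemma slice_plane_subset:
  assumes "p \<in> slice_plane I" "p \<in> slice_plane J" "p \<notin> \<real>"
  shows "slice_plane J \<subseteq> slice_plane I"
proof -
  obtain x y x' y' where p: "p = slice_point I x y" "p = slice_point J x' y'"
    using assms unfolding slice_plane_def by blast
  have y': "y' \<noteq> 0"
    using assms(3) p(2) by (auto simp: slice_point_def)
  have "y' *\<^sub>R J = of_real (x - x') + y *\<^sub>R I"
    using p by (simp add: slice_point_def scaleR_conv_of_real algebra_simps)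
  then have "J = (1 / y') *\<^sub>R (of_real (x - x') + y *\<^sub>R I)"
    using y' by (metis divide_self_if mult.commute scaleR_one scaleR_scaleR times_divide_eq_right mult_1_right)
  also have "\<dots> = of_real ((x - x') / y') + (y / y') *\<^sub>R I"
    by (simp add: scaleR_add_right of_real_def)
  finally have J: "J = of_real ((x - x') / y') + (y / y') *\<^sub>R I" .
  have "slice_point J a b = slice_point I (a + b * ((x - x') / y')) (b * (y / y'))" for a b
    unfolding slice_point_def
    by (subst J) (simp add: scaleR_conv_of_real algebra_simps flip: mult.assoc)
  then show ?thesis
    unfolding slice_plane_def by blast
qed


section \<open>The identity theorem in a slice\<close>

lemma slice_holomorphic_on_diff:
  assumes "slice_holomorphic_on I U f" "slice_holomorphic_on I U g"
  shows "slice_holomorphic_on I U (\<lambda>q. f q - g q)"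
proof -
  obtain fx fy gx gy where
    cont: "continuous_on U fx" "continuous_on U fy" "continuous_on U gx" "continuous_on U gy"
    and f: "\<forall>x y. slice_point I x y \<in> U \<longrightarrow>
         ((\<lambda>t. f (slice_point I t y)) has_vector_derivative fx (slice_point I x y)) (at x) \<and>
         ((\<lambda>t. f (slice_point I x t)) has_vector_derivative fy (slice_point I x y)) (at y) \<and>
         (1/2) *\<^sub>R (fx (slice_point I x y) + I * fy (slice_point I x y)) = 0"
    and g: "\<forall>x y. slice_point I x y \<in> U \<longrightarrow>
         ((\<lambda>t. g (slice_point I t y)) has_vector_derivative gx (slice_point I x y)) (at x) \<and>
         ((\<lambda>t. g (slice_point I x t)) has_vector_derivative gy (slice_point I x y)) (at y) \<and>
         (1/2) *\<^sub>R (gx (slice_point I x y) + I * gy (slice_point I x y)) = 0"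
    using assms unfolding slice_holomorphic_on_def by blast
  have CR: "(1/2) *\<^sub>R (fx q - gx q + I * (fy q - gy q)) = 0"
    if "(1/2) *\<^sub>R (fx q + I * fy q) = 0" "(1/2) *\<^sub>R (gx q + I * gy q) = 0" for q
  proof -
    have "fx q - gx q + I * (fy q - gy q) = (fx q + I * fy q) - (gx q + I * gy q)"
      by (simp add: algebra_simps)
    with that show ?thesis
      by simp
  qed
  show ?thesis
    unfolding slice_holomorphic_on_def
  proof (intro conjI exI allI impI)
    show "openin (top_of_set (slice_plane I)) U"
      using assms(1) by (simp add: slice_holomorphic_on_def)
    show "continuous_on U (\<lambda>q. fx q - gx q)" "continuous_on U (\<lambda>q. fy q - gy q)"
      by (intro continuous_on_diff cont)+
    fix x y assume U: "slice_point I x y \<in> U"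
    show "((\<lambda>t. f (slice_point I t y) - g (slice_point I t y)) has_vector_derivative
        fx (slice_point I x y) - gx (slice_point I x y)) (at x)"
      using f g U by (intro has_vector_derivative_diff) blast+
    show "((\<lambda>t. f (slice_point I x t) - g (slice_point I x t)) has_vector_derivative
        fy (slice_point I x y) - gy (slice_point I x y)) (at y)"
      using f g U by (intro has_vector_derivative_diff) blast+
    show "(1/2) *\<^sub>R (fx (slice_point I x y) - gx (slice_point I x y) +
        I * (fy (slice_point I x y) - gy (slice_point I x y))) = 0"
      using f g U by (intro CR) blast+
  qed
qed

text \<open>The imaginary part is forced: a functional with real part \<open>inner q v\<close> that
  turns \<open>I * q\<close> into multiplication by \<i> has as imaginary part minus its real part
  at \<open>I * q\<close>.\<close>

definition slice_functional :: "quaternion \<Rightarrow> quaternion \<Rightarrow> quaternion \<Rightarrow> complex" where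
  "slice_functional I v q = Complex (inner q v) (- inner (I * q) v)"

lemma bounded_linear_slice_functional: "bounded_linear (slice_functional I v)"
  unfolding linear_conv_bounded_linear[symmetric]
  by (rule linearI)
    (simp_all add: slice_functional_def complex_eq_iff inner_add_left distrib_left)

text \<open>Since \<open>I * (I * q) = - q\<close>, passing from \<open>q\<close> to
  \<open>I * q\<close> exchanges the two inner products up to sign, just as multiplication by \<i>
  exchanges real and imaginary part.\<close>

lemma slice_functional_mult:
  assumes "I \<in> imag_units"
  shows "slice_functional I v (I * q) = \<i> * slice_functional I v q"
proof -
  have "I * (I * q) = - q"
    using assms by (simp add: imag_units_def power2_eq_square mult.assoc[symmetric])
  then show ?thesis
    by (simp add: slice_functional_def complex_eq_iff)
qed

text \<open>The functional commutes with both partial derivatives and turns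
  \<open>hx = - (I * hy)\<close> into the Cauchy-Riemann equation for a complex function.\<close>

lemma holomorphic_slice_functional:
  assumes I: "I \<in> imag_units" and h: "slice_holomorphic_on I U h"
  shows "(\<lambda>z. slice_functional I v (h (slice_embed I z))) holomorphic_on slice_embed I -` U"
proof -
  obtain hx hy where cont: "continuous_on U hx" "continuous_on U hy"
    and d: "\<And>x y. slice_point I x y \<in> U \<Longrightarrow>
         ((\<lambda>t. h (slice_point I t y)) has_vector_derivative hx (slice_point I x y)) (at x) \<and>
         ((\<lambda>t. h (slice_point I x t)) has_vector_derivative hy (slice_point I x y)) (at y) \<and>
         (1/2) *\<^sub>R (hx (slice_point I x y) + I * hy (slice_point I x y)) = 0"
    using h unfolding slice_holomorphic_on_def by blast
  let ?\<phi> = "slice_functional I v"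
  note lin = bounded_linear_slice_functional[of I v]
  show ?thesis
  proof (rule holomorphic_on_if_continuous_partials)
    show "open (slice_embed I -` U)"
      using h by (intro open_vimage_slice_embed) (simp add: slice_holomorphic_on_def)
    show "continuous_on (slice_embed I -` U) (\<lambda>z. ?\<phi> (hy (slice_embed I z)))"
      by (intro bounded_linear.continuous_on[OF lin] continuous_on_compose2[OF cont(2)]
          continuous_on_slice_embed) auto
    fix z assume "z \<in> slice_embed I -` U"
    then have z: "slice_point I (Re z) (Im z) \<in> U"
      by (simp add: slice_embed_def)
    show "((\<lambda>t. ?\<phi> (h (slice_embed I (Complex t (Im z))))) has_vector_derivative
        ?\<phi> (hx (slice_embed I z))) (at (Re z))"
      using d[OF z] by (auto simp: slice_embed_def intro!: bounded_linear.has_vector_derivative[OF lin])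
    show "((\<lambda>t. ?\<phi> (h (slice_embed I (Complex (Re z) t)))) has_vector_derivative
        ?\<phi> (hy (slice_embed I z))) (at (Im z))"
      using d[OF z] by (auto simp: slice_embed_def intro!: bounded_linear.has_vector_derivative[OF lin])
    have "hx (slice_embed I z) = - (I * hy (slice_embed I z))"
      using d[OF z] by (simp add: slice_embed_def eq_neg_iff_add_eq_0)
    then have "?\<phi> (hx (slice_embed I z)) = - (\<i> * ?\<phi> (hy (slice_embed I z)))"
      using slice_functional_mult[OF I] linear_neg[OF bounded_linear.linear[OF lin]] by simp
    then show "?\<phi> (hy (slice_embed I z)) = \<i> * ?\<phi> (hx (slice_embed I z))"
      by simp
  qed
qed

text \<open>The complex identity theorem on a disc applies to every functional of \<open>h\<close>,
  and these functionals together separate quaternions. The disc is chosen inside the preimage of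
  \<open>U\<close>, which also yields \<open>q \<in> U\<close>.\<close>

lemma slice_identity:
  assumes I: "I \<in> imag_units" and h: "slice_holomorphic_on I U h"
    and "p \<in> U" and lim: "p islimpt {q \<in> U. h q = 0}"
  obtains e where "e > 0" "\<And>q. q \<in> ball p e \<inter> slice_plane I \<Longrightarrow> q \<in> U \<and> h q = 0"
proof -
  have U: "openin (top_of_set (slice_plane I)) U"
    using h by (simp add: slice_holomorphic_on_def)
  then have sub: "U \<subseteq> slice_plane I"
    using openin_imp_subset by blast
  with \<open>p \<in> U\<close> obtain w where w: "p = slice_embed I w"
    by (auto simp: slice_plane_eq_range)
  obtain e where e: "e > 0" "ball w e \<subseteq> slice_embed I -` U"
    using open_vimage_slice_embed[OF U] \<open>p \<in> U\<close> w by (metis openE vimageI)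
  define Z where "Z = {z \<in> ball w e. h (slice_embed I z) = 0}"
  have "w islimpt Z"
    unfolding islimpt_approachable
  proof (intro allI impI)
    fix d :: real assume "d > 0"
    \<comment> \<open>The bound \<open>e\<close> keeps the zero inside the disc, the bound
      \<open>d\<close> makes it close enough to witness accumulation.\<close>
    then obtain q where q: "q \<in> U" "h q = 0" "q \<noteq> p" "dist q p < min d e"
      using lim e(1) unfolding islimpt_approachable by (metis (mono_tags, lifting) mem_Collect_eq min_less_iff_conj)
    then obtain z where z: "q = slice_embed I z"
      using sub by (auto simp: slice_plane_eq_range)
    show "\<exists>z\<in>Z. z \<noteq> w \<and> dist z w < d"
      using q by (intro bexI[of _ z]) (auto simp: Z_def z w dist_slice_embed[OF I] dist_commute)
  qed
  have zero: "h (slice_embed I z) = 0" if z: "z \<in> ball w e" for z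
  proof -
    \<comment> \<open>Testing against the value itself: the real part of the functional is then
      \<open>inner v v\<close>, so its vanishing forces \<open>v = 0\<close>.\<close>
    define v where "v = h (slice_embed I z)"
    have "slice_functional I v (h (slice_embed I z)) = 0"
    proof (rule analytic_continuation[where f = "\<lambda>z. slice_functional I v (h (slice_embed I z))",
          OF _ _ _ _ _ \<open>w islimpt Z\<close>])
      show "(\<lambda>z. slice_functional I v (h (slice_embed I z))) holomorphic_on ball w e"
        using holomorphic_slice_functional[OF I h] e(2) by (rule holomorphic_on_subset)
    qed (use e z in \<open>auto simp: Z_def slice_functional_def complex_eq_iff\<close>)
    then show ?thesis
      by (simp add: slice_functional_def v_def complex_eq_iff)
  qed
  show thesis
  proof
    show "q \<in> U \<and> h q = 0" if "q \<in> ball p e \<inter> slice_plane I" for q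
    proof -
      obtain z where z: "q = slice_embed I z"
        using \<open>q \<in> _\<close> by (auto simp: slice_plane_eq_range)
      then have "z \<in> ball w e"
        using that by (simp add: w dist_slice_embed[OF I])
      then show ?thesis
        using e(2) zero z by auto
    qed
  qed (fact e(1))
qed


section \<open>The identity principle\<close>

text \<open>This carries accumulation of zeros from one slice to another: the real points near
  \<open>p\<close> are zeros found in the slice of \<open>I\<close>, and they lie in the slice of
  \<open>J\<close> too.\<close>

lemma islimpt_Int_slice_plane_if_real:
  assumes I: "I \<in> imag_units" and h: "slice_holomorphic_on I (\<Omega> \<inter> slice_plane I) h"
    and "p \<in> \<Omega>" "p \<in> \<real>"
    and lim: "p islimpt {q \<in> \<Omega> \<inter> slice_plane I. h q = 0}"
  shows "p islimpt {q \<in> \<Omega> \<inter> slice_plane J. h q = 0}"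
proof -
  obtain r where r: "p = of_real r"
    using \<open>p \<in> \<real>\<close> by (auto elim: Reals_cases)
  obtain e where e: "e > 0"
    and zero: "\<And>q. q \<in> ball p e \<inter> slice_plane I \<Longrightarrow> q \<in> \<Omega> \<inter> slice_plane I \<and> h q = 0"
    using slice_identity[OF I h _ lim] \<open>p \<in> \<Omega>\<close> r by auto
  show ?thesis
    unfolding islimpt_approachable
  proof (intro allI impI)
    fix d :: real assume "d > 0"
    \<comment> \<open>Half of \<open>min d e\<close> keeps the real point within both radii and
      different from \<open>p\<close>.\<close>
    define s where "s = r + min d e / 2"
    have "dist (of_real s) p = min d e / 2"
      unfolding r s_def dist_of_real using e \<open>d > 0\<close> by (simp add: dist_real_def)
    then have s: "dist (of_real s) p < d" "of_real s \<in> ball p e" "of_real s \<noteq> p"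
      using e \<open>d > 0\<close> by (auto simp: dist_commute)
    with zero[of "of_real s"]
    show "\<exists>q\<in>{q \<in> \<Omega> \<inter> slice_plane J. h q = 0}. q \<noteq> p \<and> dist q p < d"
      by (intro bexI[of _ "of_real s"]) auto
  qed
qed

theorem theorem4p3:
  fixes \<Omega> :: "quaternion set" and f g :: "quaternion \<Rightarrow> quaternion"
  assumes "slice_domain \<Omega>" and "real_connected \<Omega>"
    and "slice_regular_on \<Omega> f" and "slice_regular_on \<Omega> g"
    and "\<exists>I\<in>imag_units. \<exists>A \<subseteq> \<Omega> \<inter> slice_plane I.
           (\<forall>q\<in>A. f q = g q) \<and> (\<exists>p \<in> \<Omega> \<inter> slice_plane I. p islimpt A)"
  shows "\<forall>q\<in>\<Omega>. f q = g q"
proof -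
  define h where "h q = f q - g q" for q
  define Z where "Z I = {q \<in> \<Omega> \<inter> slice_plane I. h q = 0}" for I
  \<comment> \<open>Limit points of zeros are used instead of zeros: this condition is closed in
    each slice, and the identity theorem makes it open as well.\<close>
  define W where "W = {p \<in> \<Omega>. \<exists>I\<in>imag_units. p \<in> slice_plane I \<and> p islimpt Z I}"
  have hol: "slice_holomorphic_on I (\<Omega> \<inter> slice_plane I) h" if "I \<in> imag_units" for I
    using slice_holomorphic_on_diff assms(3,4) that
    unfolding h_def slice_regular_on_def by blast
  have open_\<Omega>: "openin (top_of_set (slice_plane I)) (\<Omega> \<inter> slice_plane I)" if "I \<in> imag_units" for I
    using assms(1) that by (simp add: slice_domain_def openin_slice_topology_iff)
  \<comment> \<open>The slice witnessing membership in \<open>W\<close> can be replaced by any slice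
    through the point: at a real point accumulation transfers, and a nonreal point lies in only one
    plane.\<close>
  have W_slice: "W \<inter> slice_plane I = {p \<in> \<Omega> \<inter> slice_plane I. p islimpt Z I}"
    if I: "I \<in> imag_units" for I
  proof -
    have "p islimpt Z I" if "p \<in> W" "p \<in> slice_plane I" for p
    proof -
      obtain J where J: "J \<in> imag_units" "p \<in> slice_plane J" "p islimpt Z J" and "p \<in> \<Omega>"
        using \<open>p \<in> W\<close> unfolding W_def by blast
      show ?thesis
      proof (cases "p \<in> \<real>")
        case True
        then show ?thesis
          using islimpt_Int_slice_plane_if_real[OF J(1) hol] J \<open>p \<in> \<Omega>\<close> unfolding Z_def by blast
      next
        case False
        then have "slice_plane I = slice_plane J"
          using J that slice_plane_subset by (intro subset_antisym) blast+
        with J show ?thesis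
          by (simp add: Z_def)
      qed
    qed
    then show ?thesis
      using I by (auto simp: W_def)
  qed
  have near: "\<exists>e>0. \<forall>q\<in>ball p e \<inter> slice_plane I. q \<in> Z I"
    if I: "I \<in> imag_units" and "p \<in> W" "p \<in> slice_plane I" for I p
  proof -
    have "p \<in> \<Omega> \<inter> slice_plane I" "p islimpt Z I"
      using that W_slice[OF I] by blast+
    then show ?thesis
      using slice_identity[OF I hol[OF I]] unfolding Z_def by (metis (mono_tags, lifting) mem_Collect_eq)
  qed
  have "openin slice_topology W"
    unfolding openin_slice_topology_iff
  proof
    fix I assume I: "I \<in> imag_units"
    have "\<exists>e>0. ball p e \<inter> slice_plane I \<subseteq> W \<inter> slice_plane I" if p: "p \<in> W" "p \<in> slice_plane I" for p
    proof -
      obtain e where e: "e > 0" "\<forall>q\<in>ball p e \<inter> slice_plane I. q \<in> Z I"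
        using near[OF I p] by blast
      \<comment> \<open>A slice has no isolated points, as shifts by \<open>d / 2\<close> show, so
        zeros filling a relative ball accumulate at each of its points.\<close>
      have "q islimpt Z I" if q: "q \<in> ball p e" "q \<in> slice_plane I" for q
      proof -
        have "q islimpt slice_plane I"
        proof -
          obtain z where z: "q = slice_embed I z"
            using q by (auto simp: slice_plane_eq_range)
          show ?thesis
            unfolding islimpt_approachable
          proof (intro allI impI)
            fix d :: real assume "d > 0"
            then show "\<exists>x'\<in>slice_plane I. x' \<noteq> q \<and> dist x' q < d"
              using dist_slice_embed[OF I, of "z + of_real (d / 2)" z]
              by (intro bexI[of _ "slice_embed I (z + of_real (d / 2))"])
                (auto simp: z slice_plane_eq_range dist_norm norm_of_real simp del: of_real_divide)
          qed
        qed
        then have "q islimpt slice_plane I \<inter> ball p e"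
          using q by (intro islimpt_Int_eventually eventually_at_in_open') auto
        then show ?thesis
          by (rule islimpt_subset) (use e in auto)
      qed
      then show ?thesis
        using e I W_slice[OF I] by (intro exI[of _ e]) (auto simp: Z_def)
    qed
    then show "openin (top_of_set (slice_plane I)) (W \<inter> slice_plane I)"
      by (auto simp: openin_contains_ball)
  qed
  moreover have "openin slice_topology (\<Omega> - W)"
    unfolding openin_slice_topology_iff
  proof
    fix I assume I: "I \<in> imag_units"
    \<comment> \<open>In a slice, removing \<open>W\<close> amounts to removing all limit points of
      one set, and those form a closed set.\<close>
    have "(\<Omega> - W) \<inter> slice_plane I = (\<Omega> \<inter> slice_plane I) - {p. p islimpt Z I}"
      using W_slice[OF I] by blast
    moreover have "closed {p. p islimpt Z I}"
      by (rule closed_limpts)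
    ultimately show "openin (top_of_set (slice_plane I)) ((\<Omega> - W) \<inter> slice_plane I)"
      using open_\<Omega>[OF I] by (metis Diff_eq open_Compl openin_Int_open)
  qed
  moreover have "W \<noteq> {}"
  proof -
    obtain I A p where *: "I \<in> imag_units" "A \<subseteq> \<Omega> \<inter> slice_plane I" "\<forall>q\<in>A. f q = g q"
      "p \<in> \<Omega> \<inter> slice_plane I" "p islimpt A"
      using assms(5) by blast
    then have "A \<subseteq> Z I"
      by (auto simp: Z_def h_def)
    with * have "p \<in> W"
      by (auto simp: W_def intro: islimpt_subset)
    then show ?thesis
      by blast
  qed
  moreover have "connectedin slice_topology \<Omega>" "W \<subseteq> \<Omega>"
    using assms(1) by (auto simp: slice_domain_def W_def)
  ultimately have "\<Omega> - W = {}"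
    unfolding connectedin by blast
  show ?thesis
  proof
    fix q assume "q \<in> \<Omega>"
    with \<open>\<Omega> - W = {}\<close> have "q \<in> W"
      by blast
    then obtain I where I: "I \<in> imag_units" "q \<in> slice_plane I"
      by (auto simp: W_def)
    \<comment> \<open>Membership in \<open>W\<close> only says that zeros accumulate at
      \<open>q\<close>; that \<open>q\<close> itself is a zero comes from the ball of zeros around
      it.\<close>
    obtain e where "e > 0" "\<forall>q\<in>ball q e \<inter> slice_plane I. q \<in> Z I"
      using near[OF I(1) \<open>q \<in> W\<close> I(2)] by blast
    then have "q \<in> Z I"
      using I by simp
    then show "f q = g q"
      by (simp add: Z_def h_def)
  qed
qed

end
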